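(* Let $\mathcal{C}$ be a convex curve (an arc including its endpoints) with affine curvature bounds $k_0\le\kappa\le k_1$, where $k_0,k_1$ are constants with $k_1\le(\pi/\Lambda(\mathcal{C}))^2$. Let $p_1,p_2,p_3$ be distinct points on $\mathcal{C}$ and let $L=\Lambda(\mathcal{C})/2$. Then $$\operatorname{Area}(\triangle p_1p_2p_3)\le\bar x_{k_0}(L)\,\bar y_{k_0}(L).$$ Equality holds if and only if $\mathcal{C}$ has constant affine curvature $k_0$ and, after possibly reordering, the points $p_1,p_2,p_3$ are the initial point, the midpoint (with respect to affine arc length), and the endpoint of $\mathcal{C}$.
   Context: For $v,w\in\mathbb{R}^2$ put $v\wedge w=v_1w_2-v_2w_1$. A $C^3$ curve $c$ has affine unit speed if $c'\wedge c''\equiv1$; its affine curvature $\kappa$ is defined by $c'''=-\kappa c'$. A convex curve is an embedded connected curve contained in the boundary of its convex hull; it is assumed to admit an affine unit speed $C^3$ parameterization, here $c\colon[0,\Lambda(\mathcal{C})]\to\mathcal{C}$, where $\Lambda(\mathcal{C})$ is the affine arc length. For $k\in\mathbb{R}$: $\bar x_k(s)=\sin(\sqrt k\,s)/\sqrt k$ if $k>0$, $\bar x_0(s)=s$, $\bar x_k(s)=\sinh(\sqrt{|k|}\,s)/\sqrt{|k|}$ if $k<0$; and $\bar y_k(s)=(1-\cos(\sqrt k\,s))/k$ if $k>0$, $\bar y_0(s)=s^2/2$, $\bar y_k(s)=(1-\cosh(\sqrt{|k|}\,s))/k$ if $k<0$. *)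

theory Defs
  imports "HOL-Analysis.Analysis"
begin

definition wedge :: "real^2 \<Rightarrow> real^2 \<Rightarrow> real" where
  "wedge v w = v $ 1 * w $ 2 - v $ 2 * w $ 1"

text \<open>Derivative relative to a closed parameter interval \<open>S\<close>, so one-sided at its endpoints.\<close>

definition deriv_on :: "real set \<Rightarrow> (real \<Rightarrow> real^2) \<Rightarrow> real \<Rightarrow> real^2" where
  "deriv_on S c t = vector_derivative c (at t within S)"

definition C3_curve_on :: "real set \<Rightarrow> (real \<Rightarrow> real^2) \<Rightarrow> bool" where
  "C3_curve_on S c \<longleftrightarrow>
     c differentiable_on S \<and>
     deriv_on S c differentiable_on S \<and>
     deriv_on S (deriv_on S c) differentiable_on S \<and>
     continuous_on S (deriv_on S (deriv_on S (deriv_on S c)))"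

definition affine_unit_speed_on :: "real set \<Rightarrow> (real \<Rightarrow> real^2) \<Rightarrow> bool" where
  "affine_unit_speed_on S c \<longleftrightarrow>
     (\<forall>t\<in>S. wedge (deriv_on S c t) (deriv_on S (deriv_on S c) t) = 1)"

text \<open>\<open>c\<close> is a bijective affine unit speed \<open>C\<^sup>3\<close> parameterization of \<open>\<C>\<close> on \<open>[0, \<Lambda>]\<close>; the
  affine arc length of \<open>\<C>\<close> is the length \<open>\<Lambda>\<close> of the parameter interval. As \<open>[0, \<Lambda>]\<close> is
  compact, the continuous bijection \<open>c\<close> is automatically an embedding.\<close>

definition affine_unit_speed_param :: "(real^2) set \<Rightarrow> real \<Rightarrow> (real \<Rightarrow> real^2) \<Rightarrow> bool" where
  "affine_unit_speed_param \<C> \<Lambda> c \<longleftrightarrow>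
     0 < \<Lambda> \<and> C3_curve_on {0..\<Lambda>} c \<and> affine_unit_speed_on {0..\<Lambda>} c \<and> bij_betw c {0..\<Lambda>} \<C>"

text \<open>A convex curve that is an arc including its endpoints. The existence of an affine unit speed
  \<open>C\<^sup>3\<close> parameterization is a standing assumption on convex curves.\<close>

definition convex_arc :: "(real^2) set \<Rightarrow> bool" where
  "convex_arc \<C> \<longleftrightarrow>
     (\<exists>g. arc g \<and> path_image g = \<C>) \<and>
     \<C> \<subseteq> frontier (convex hull \<C>) \<and>
     (\<exists>\<Lambda> c. affine_unit_speed_param \<C> \<Lambda> c)"

text \<open>The affine curvature is the function \<open>\<kappa>\<close> with \<open>c''' = - \<kappa> c'\<close>.\<close>

definition affine_curvature :: "real set \<Rightarrow> (real \<Rightarrow> real^2) \<Rightarrow> real \<Rightarrow> real" where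
  "affine_curvature S c t =
     (THE k. deriv_on S (deriv_on S (deriv_on S c)) t = - k *\<^sub>R deriv_on S c t)"

definition xbar :: "real \<Rightarrow> real \<Rightarrow> real" where
  "xbar k s =
     (if k > 0 then sin (sqrt k * s) / sqrt k
      else if k = 0 then s
      else sinh (sqrt \<bar>k\<bar> * s) / sqrt \<bar>k\<bar>)"

definition ybar :: "real \<Rightarrow> real \<Rightarrow> real" where
  "ybar k s =
     (if k > 0 then (1 - cos (sqrt k * s)) / k
      else if k = 0 then s\<^sup>2 / 2
      else (1 - cosh (sqrt \<bar>k\<bar> * s)) / k)"

definition triangle_area :: "real^2 \<Rightarrow> real^2 \<Rightarrow> real^2 \<Rightarrow> real" where
  "triangle_area p q r = measure lebesgue (convex hull {p, q, r})"

text \<open>The definite description in \<open>affine_curvature\<close> is well defined: differentiating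
  \<open>c' \<and> c'' = 1\<close> gives \<open>c' \<and> c''' = 0\<close>, where \<open>c' \<noteq> 0\<close>.\<close>

lemma has_vector_derivative_deriv_on:
  assumes "f differentiable_on S" "t \<in> S"
  shows "(f has_vector_derivative deriv_on S f t) (at t within S)"
  using assms unfolding deriv_on_def differentiable_on_def
  by (simp add: vector_derivative_works[symmetric])

lemma wedge_parallel:
  assumes "wedge v w = 0" "v \<noteq> 0"
  shows "\<exists>!k. w = - k *\<^sub>R v"
proof -
  have e: "v $ 1 * w $ 2 = v $ 2 * w $ 1"
    using assms(1) by (simp add: wedge_def)
  have "v $ 1 \<noteq> 0 \<or> v $ 2 \<noteq> 0"
    using assms(2) by (auto simp: vec_eq_iff forall_2)
  then have "\<exists>k. w = - k *\<^sub>R v"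
  proof
    assume "v $ 1 \<noteq> 0"
    then show ?thesis
      using e by (intro exI[of _ "- (w $ 1 / v $ 1)"]) (auto simp: vec_eq_iff forall_2 field_simps)
  next
    assume "v $ 2 \<noteq> 0"
    then show ?thesis
      using e by (intro exI[of _ "- (w $ 2 / v $ 2)"]) (auto simp: vec_eq_iff forall_2 field_simps)
  qed
  then show ?thesis using assms(2) by auto
qed

lemma affine_curvature:
  assumes "affine_unit_speed_param \<C> \<Lambda> c" and t: "t \<in> {0..\<Lambda>}"
  defines "D \<equiv> deriv_on {0..\<Lambda>}"
  shows "D (D (D c)) t = - affine_curvature {0..\<Lambda>} c t *\<^sub>R D c t"
proof -
  have L: "0 < \<Lambda>" and "C3_curve_on {0..\<Lambda>} c"
    and u: "\<And>s. s \<in> {0..\<Lambda>} \<Longrightarrow> wedge (D c s) (D (D c) s) = 1"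
    using assms by (auto simp: affine_unit_speed_param_def affine_unit_speed_on_def)
  then have d: "(D c has_vector_derivative D (D c) t) (at t within {0..\<Lambda>})"
    "(D (D c) has_vector_derivative D (D (D c)) t) (at t within {0..\<Lambda>})"
    unfolding D_def C3_curve_on_def using t by (auto intro: has_vector_derivative_deriv_on)
  have nth: "((\<lambda>s. f s $ i) has_real_derivative f' $ i) (at t within {0..\<Lambda>})"
    if "(f has_vector_derivative f') (at t within {0..\<Lambda>})" for f :: "real \<Rightarrow> real^2" and f' i
    using bounded_linear.has_vector_derivative[OF bounded_linear_vec_nth that, of i]
    by (simp add: has_real_derivative_iff_has_vector_derivative)
  have "((\<lambda>s. wedge (D c s) (D (D c) s)) has_real_derivative wedge (D c t) (D (D (D c)) t))
      (at t within {0..\<Lambda>})"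
    unfolding wedge_def
    by (rule DERIV_cong, (rule DERIV_diff DERIV_mult nth d)+) (simp add: algebra_simps)
  then have "((\<lambda>s. 1) has_vector_derivative wedge (D c t) (D (D (D c)) t)) (at t within {0..\<Lambda>})"
    unfolding has_real_derivative_iff_has_vector_derivative
    by (rule has_vector_derivative_transform[OF t, rotated]) (simp add: u)
  then have "wedge (D c t) (D (D (D c)) t) = 0"
    using vector_derivative_unique_within_closed_interval[of 0 \<Lambda> t "\<lambda>s. 1::real"] L t
    by (metis has_vector_derivative_const cbox_interval)
  moreover have "D c t \<noteq> 0"
    using u[OF t] by (auto simp: wedge_def)
  ultimately have "\<exists>!k. D (D (D c)) t = - k *\<^sub>R D c t"
    by (rule wedge_parallel)
  then show ?thesis
    unfolding affine_curvature_def D_def by (rule theI')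
qed

end

theory Submission
  imports Defs
begin

text \<open>Write \<open>v \<and> w\<close> for \<open>wedge v w\<close>. For \<open>a < b < d\<close>, twice the area of the triangle with vertices
  \<open>c a\<close>, \<open>c b\<close>, \<open>c d\<close> is the absolute value of \<open>(c b - c a) \<and> (c d - c b)\<close>, which is the double
  integral of \<open>c' s \<and> c' t\<close> over \<open>a \<le> s \<le> b \<le> t \<le> d\<close>. For fixed \<open>s\<close>, the function
  \<open>t \<mapsto> c' s \<and> c' t\<close> solves the Jacobi equation \<open>u'' = - \<kappa> u\<close>, vanishes at \<open>s\<close> and has slope
  \<open>c' s \<and> c'' s = 1\<close> there. So two Sturm comparisons apply to it. Since \<open>\<kappa> \<le> (\<pi> / \<Lambda>)\<^sup>2\<close>, it is
  positive for \<open>t - s < \<Lambda>\<close>; hence the double integral is positive and needs no absolute value.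
  Since \<open>\<kappa> \<ge> k\<close>, it is at most the solution \<open>xbar k (t - s)\<close> for constant curvature \<open>k\<close>
  (\<open>wedge_tangents_pos\<close>, \<open>wedge_tangents_le\<close>).

  Integrating the upper bound leaves the function \<open>model_area k (b - a) (d - b)\<close> of the two affine
  lengths alone. As \<open>xbar k\<close> is positive, this function increases when an arc is extended and, for
  total length \<open>\<Lambda>\<close>, is largest for two equal arcs (\<open>model_area_le_balanced\<close>); its value there is
  \<open>2 * xbar k L * ybar k L\<close>.

  In the case of equality the vertices are therefore the two endpoints and the midpoint, and the
  comparison \<open>c' s \<and> c' t \<le> xbar k (t - s)\<close> is an equality on the whole open rectangle of
  integration. Two solutions in a Sturm comparison that meet a second time have the same
  coefficient in between (\<open>sturm_rigidity\<close>), so that \<open>\<kappa> = k\<close> in the interior, and at the ends by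
  continuity. Conversely, for \<open>\<kappa> = k\<close> the comparison holds in both directions.\<close>

section \<open>Monotonicity on compact intervals\<close>

lemma continuous_on_of_derivative_Icc:
  fixes g :: "real \<Rightarrow> real"
  assumes "\<forall>x\<in>{a..b}. (g has_real_derivative g' x) (at x within {a..b})"
  shows "continuous_on {a..b} g"
  using assms DERIV_continuous_on by blast

lemma derivative_at_interior_Icc:
  fixes g :: "real \<Rightarrow> real"
  assumes "\<forall>x\<in>{a..b}. (g has_real_derivative g' x) (at x within {a..b})"
    and "x \<in> {a<..<b}"
  shows "(g has_real_derivative g' x) (at x)"
  using bspec[OF assms(1), of x] assms(2) by (simp add: at_within_Icc_at)

lemma nondecreasing_Icc:
  fixes g :: "real \<Rightarrow> real"
  assumes d: "\<forall>x\<in>{a..b}. (g has_real_derivative g' x) (at x within {a..b})"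
    and nn: "\<forall>x\<in>{a<..<b}. 0 \<le> g' x"
    and le: "a \<le> s" "s \<le> t" "t \<le> b"
  shows "g s \<le> g t"
proof (rule DERIV_nonneg_imp_increasing_open[OF \<open>s \<le> t\<close>])
  fix x assume "s < x" "x < t"
  then have x: "x \<in> {a<..<b}" using le by simp
  show "\<exists>y. (g has_real_derivative y) (at x) \<and> 0 \<le> y"
    using derivative_at_interior_Icc[OF d x] bspec[OF nn x] by blast
next
  show "continuous_on {s..t} g"
    by (rule continuous_on_subset[OF continuous_on_of_derivative_Icc[OF d]]) (use le in simp)
qed

lemma nondecreasing_Icc_rigid:
  fixes g :: "real \<Rightarrow> real"
  assumes d: "\<forall>x\<in>{a..b}. (g has_real_derivative g' x) (at x within {a..b})"
    and nn: "\<forall>x\<in>{a<..<b}. 0 \<le> g' x"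
    and eq: "g a = g b" and x: "x \<in> {a<..<b}"
  shows "g' x = 0"
proof -
  have "g a = g t" if "t \<in> {a<..<b}" for t
  proof -
    have t: "a \<le> t" "t \<le> b" using that by auto
    have "g a \<le> g t" by (rule nondecreasing_Icc[OF d nn order.refl t])
    moreover have "g t \<le> g b" by (rule nondecreasing_Icc[OF d nn t order.refl])
    ultimately show ?thesis using eq by simp
  qed
  then have "((\<lambda>_. g a) has_real_derivative g' x) (at x)"
    by (intro has_field_derivative_transform_within_open
          [OF derivative_at_interior_Icc[OF d x], where S = "{a<..<b}"] x) simp_all
  then show ?thesis by (rule DERIV_unique[OF _ DERIV_const])
qed

text \<open>The mixed second difference of \<open>h\<close> over a rectangle is the double integral of the mixed second
  derivative of \<open>h\<close>. So if the latter is nonnegative, then so is the difference, which vanishes only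
  together with it. Applying the one variable statements in each direction gives this without any
  integration.\<close>

lemma mixed_difference:
  fixes h :: "real \<Rightarrow> real \<Rightarrow> real"
  assumes d1: "\<And>t. t \<in> {e..d} \<Longrightarrow>
      \<forall>s\<in>{a..b}. ((\<lambda>s. h s t) has_real_derivative h1 s t) (at s within {a..b})"
    and d2: "\<And>s. s \<in> {a..b} \<Longrightarrow>
      \<forall>t\<in>{e..d}. (h1 s has_real_derivative h12 s t) (at t within {e..d})"
    and nn: "\<And>s t. s \<in> {a<..<b} \<Longrightarrow> t \<in> {e<..<d} \<Longrightarrow> 0 \<le> h12 s t"
    and le: "a \<le> b" "e \<le> d"
  shows mixed_difference_nonneg: "0 \<le> h b d - h b e - h a d + h a e"
    and mixed_difference_rigid: "h b d - h b e - h a d + h a e = 0 \<Longrightarrow>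
      s \<in> {a<..<b} \<Longrightarrow> t \<in> {e<..<d} \<Longrightarrow> h12 s t = 0"
proof -
  have nn': "\<forall>t\<in>{e<..<d}. 0 \<le> h12 s t" if "s \<in> {a<..<b}" for s
    using nn[OF that] by blast
  have d2': "\<forall>t\<in>{e..d}. (h1 s has_real_derivative h12 s t) (at t within {e..d})"
    if "s \<in> {a<..<b}" for s
    using that by (intro d2) simp
  have D: "\<forall>s\<in>{a..b}. ((\<lambda>s. h s d - h s e) has_real_derivative h1 s d - h1 s e) (at s within {a..b})"
  proof
    fix s assume "s \<in> {a..b}"
    then show "((\<lambda>s. h s d - h s e) has_real_derivative h1 s d - h1 s e) (at s within {a..b})"
      using d1[of d] d1[of e] le by (intro DERIV_diff) simp_all
  qed
  have N: "\<forall>s\<in>{a<..<b}. 0 \<le> h1 s d - h1 s e"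
    using nondecreasing_Icc[OF d2' nn' order.refl le(2) order.refl] by simp
  show "0 \<le> h b d - h b e - h a d + h a e"
    using nondecreasing_Icc[OF D N order.refl le(1) order.refl] by simp
  assume eq: "h b d - h b e - h a d + h a e = 0" and s: "s \<in> {a<..<b}" and t: "t \<in> {e<..<d}"
  have "h1 s d - h1 s e = 0"
    by (rule nondecreasing_Icc_rigid[OF D N _ s]) (use eq in simp)
  then show "h12 s t = 0"
    by (intro nondecreasing_Icc_rigid[OF d2'[OF s] nn'[OF s] _ t]) simp
qed

section \<open>Sturm comparison\<close>

text \<open>Normalized solutions of \<open>u'' = - \<kappa> u\<close>; the derivative is carried along as a second function
  so that no choice of derivative is involved at the endpoints.\<close>

definition jacobi_on :: "real \<Rightarrow> real \<Rightarrow> (real \<Rightarrow> real) \<Rightarrow> (real \<Rightarrow> real) \<Rightarrow> (real \<Rightarrow> real) \<Rightarrow> bool" where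
  "jacobi_on \<alpha> \<beta> \<kappa> u u' \<longleftrightarrow>
     (\<forall>t\<in>{\<alpha>..\<beta>}. (u has_real_derivative u' t) (at t within {\<alpha>..\<beta>})) \<and>
     (\<forall>t\<in>{\<alpha>..\<beta>}. (u' has_real_derivative - \<kappa> t * u t) (at t within {\<alpha>..\<beta>})) \<and>
     u \<alpha> = 0 \<and> u' \<alpha> = 1"

lemma jacobi_onD:
  assumes "jacobi_on \<alpha> \<beta> \<kappa> u u'"
  shows "\<forall>t\<in>{\<alpha>..\<beta>}. (u has_real_derivative u' t) (at t within {\<alpha>..\<beta>})"
    and "\<forall>t\<in>{\<alpha>..\<beta>}. (u' has_real_derivative - \<kappa> t * u t) (at t within {\<alpha>..\<beta>})"
    and "u \<alpha> = 0" and "u' \<alpha> = 1"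
  using assms unfolding jacobi_on_def by blast+

lemma jacobi_on_subinterval:
  assumes "jacobi_on \<alpha> \<beta> \<kappa> u u'" "\<gamma> \<le> \<beta>"
  shows "jacobi_on \<alpha> \<gamma> \<kappa> u u'"
proof -
  have "\<forall>t\<in>{\<alpha>..\<gamma>}. (w has_real_derivative w' t) (at t within {\<alpha>..\<gamma>})"
    if w: "\<forall>t\<in>{\<alpha>..\<beta>}. (w has_real_derivative w' t) (at t within {\<alpha>..\<beta>})" for w w'
  proof
    fix t assume "t \<in> {\<alpha>..\<gamma>}"
    then have t: "t \<in> {\<alpha>..\<beta>}" using assms(2) by simp
    show "(w has_real_derivative w' t) (at t within {\<alpha>..\<gamma>})"
      by (rule DERIV_subset[OF bspec[OF w t]]) (use assms(2) in simp)
  qed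
  note sub = this[OF jacobi_onD(1)[OF assms(1)]] this[OF jacobi_onD(2)[OF assms(1)]]
  show ?thesis
    unfolding jacobi_on_def by (intro conjI sub jacobi_onD(3,4)[OF assms(1)])
qed

text \<open>The quotient rule gives \<open>(u / v)' = W / v\<^sup>2\<close> with \<open>W = u' v - u v'\<close>, where \<open>W\<close> vanishes at the
  left endpoint and \<open>W' = (q - p) u v \<ge> 0\<close>.\<close>

lemma jacobi_quotient_nondecreasing:
  assumes u: "jacobi_on \<alpha> \<beta> p u u'" and v: "jacobi_on \<alpha> \<beta> q v v'"
    and upos: "\<forall>t\<in>{\<alpha><..<\<beta>}. 0 < u t" and vpos: "\<forall>t\<in>{\<alpha><..<\<beta>}. 0 < v t"
    and pq: "\<forall>t\<in>{\<alpha><..<\<beta>}. p t \<le> q t"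
    and st: "\<alpha> < s" "s \<le> t" "t < \<beta>"
  shows "u s / v s \<le> u t / v t"
proof -
  define W where "W = (\<lambda>t. u' t * v t - u t * v' t)"
  have dW: "\<forall>y\<in>{\<alpha>..\<beta>}. (W has_real_derivative (q y - p y) * (u y * v y)) (at y within {\<alpha>..\<beta>})"
  proof
    fix y assume y: "y \<in> {\<alpha>..\<beta>}"
    note d = jacobi_onD(1,2)[OF u, THEN bspec, OF y] jacobi_onD(1,2)[OF v, THEN bspec, OF y]
    show "(W has_real_derivative (q y - p y) * (u y * v y)) (at y within {\<alpha>..\<beta>})"
      unfolding W_def
      by (rule DERIV_cong, (rule DERIV_diff DERIV_mult d)+) (simp add: algebra_simps)
  qed
  have nW: "\<forall>y\<in>{\<alpha><..<\<beta>}. 0 \<le> (q y - p y) * (u y * v y)"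
    using upos vpos pq by (intro ballI mult_nonneg_nonneg) (simp_all add: less_imp_le)
  have W: "0 \<le> W x" if "x \<in> {\<alpha><..<\<beta>}" for x
  proof -
    have "W \<alpha> \<le> W x" by (rule nondecreasing_Icc[OF dW nW order.refl]) (use that in simp_all)
    then show ?thesis by (simp add: W_def jacobi_onD(3)[OF u] jacobi_onD(3)[OF v])
  qed
  show ?thesis
  proof (rule DERIV_nonneg_imp_nondecreasing[OF st(2)])
    fix y assume "s \<le> y" "y \<le> t"
    then have y: "y \<in> {\<alpha><..<\<beta>}" using st by simp
    have "((\<lambda>y. u y / v y) has_real_derivative W y / (v y * v y)) (at y)"
      unfolding W_def
      by (intro DERIV_divide derivative_at_interior_Icc[OF jacobi_onD(1)[OF u] y]
            derivative_at_interior_Icc[OF jacobi_onD(1)[OF v] y]) (use bspec[OF vpos y] in simp)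
    then show "\<exists>z. ((\<lambda>y. u y / v y) has_real_derivative z) (at y) \<and> 0 \<le> z"
      using W[OF y] by (intro exI[of _ "W y / (v y * v y)"] conjI) simp_all
  qed
qed

text \<open>Both solutions have slope \<open>1\<close> at their common zero, so their quotient starts at \<open>1\<close>.\<close>

lemma jacobi_quotient_tendsto_1:
  assumes u: "jacobi_on \<alpha> \<beta> p u u'" and v: "jacobi_on \<alpha> \<beta> q v v'" and "\<alpha> < \<beta>"
  shows "((\<lambda>t. u t / v t) \<longlongrightarrow> 1) (at_right \<alpha>)"
proof -
  have *: "((\<lambda>t. w t / (t - \<alpha>)) \<longlongrightarrow> 1) (at_right \<alpha>)" if w: "jacobi_on \<alpha> \<beta> \<kappa> w w'" for \<kappa> w w'
  proof -
    have "(w has_real_derivative 1) (at \<alpha> within {\<alpha>..\<beta>})"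
      using bspec[OF jacobi_onD(1)[OF w], of \<alpha>] jacobi_onD(4)[OF w] \<open>\<alpha> < \<beta>\<close> by simp
    then show ?thesis
      using \<open>\<alpha> < \<beta>\<close> jacobi_onD(3)[OF w] by (simp add: has_field_derivative_iff at_within_Icc_at_right)
  qed
  have "((\<lambda>t. (u t / (t - \<alpha>)) / (v t / (t - \<alpha>))) \<longlongrightarrow> 1 / 1) (at_right \<alpha>)"
    by (intro tendsto_divide *[OF u] *[OF v]) simp
  moreover have "\<forall>\<^sub>F t in at_right \<alpha>. (u t / (t - \<alpha>)) / (v t / (t - \<alpha>)) = u t / v t"
    using eventually_at_right_real[OF \<open>\<alpha> < \<beta>\<close>] by eventually_elim simp
  ultimately show ?thesis
    using Lim_transform_eventually by fastforce
qed

lemma jacobi_comparison_of_pos: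
  assumes u: "jacobi_on \<alpha> \<beta> p u u'" and v: "jacobi_on \<alpha> \<beta> q v v'"
    and upos: "\<forall>t\<in>{\<alpha><..<\<beta>}. 0 < u t" and vpos: "\<forall>t\<in>{\<alpha><..<\<beta>}. 0 < v t"
    and pq: "\<forall>t\<in>{\<alpha><..<\<beta>}. p t \<le> q t"
    and t: "t \<in> {\<alpha><..<\<beta>}"
  shows "v t \<le> u t"
proof -
  have "\<alpha> < \<beta>" "\<alpha> < t" "t < \<beta>" using t by simp_all
  have "1 \<le> u t / v t"
  proof (rule tendsto_upperbound[OF jacobi_quotient_tendsto_1[OF u v \<open>\<alpha> < \<beta>\<close>]])
    show "\<forall>\<^sub>F s in at_right \<alpha>. u s / v s \<le> u t / v t"
      using eventually_at_right_real[OF \<open>\<alpha> < t\<close>]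
      by eventually_elim
         (rule jacobi_quotient_nondecreasing[OF u v upos vpos pq], use \<open>t < \<beta>\<close> in simp_all)
  qed simp
  then show ?thesis using bspec[OF vpos t] by (simp add: field_simps)
qed

text \<open>Positivity of \<open>u\<close> comes for free: \<open>u\<close> is positive just after \<open>\<alpha>\<close>, and up to its first
  zero \<open>\<tau>\<close> the previous comparison holds, so that \<open>u \<tau> \<ge> v \<tau> > 0\<close> by continuity.\<close>

lemma sturm_positivity:
  assumes u: "jacobi_on \<alpha> \<beta> p u u'" and v: "jacobi_on \<alpha> \<beta> q v v'"
    and vpos: "\<forall>t\<in>{\<alpha><..<\<beta>}. 0 < v t" and pq: "\<forall>t\<in>{\<alpha><..<\<beta>}. p t \<le> q t"
  shows "\<forall>t\<in>{\<alpha><..<\<beta>}. 0 < u t"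
proof (rule ccontr)
  assume "\<not> (\<forall>t\<in>{\<alpha><..<\<beta>}. 0 < u t)"
  then obtain t where t: "\<alpha> < t" "t < \<beta>" and neg: "u t \<le> 0"
    by (auto simp: not_less)
  note cu = continuous_on_of_derivative_Icc[OF jacobi_onD(1)[OF u]]
  note cv = continuous_on_of_derivative_Icc[OF jacobi_onD(1)[OF v]]
  have "(u has_real_derivative 1) (at \<alpha> within {\<alpha>..\<beta>})"
    using bspec[OF jacobi_onD(1)[OF u], of \<alpha>] jacobi_onD(4)[OF u] t by simp
  from has_real_derivative_pos_inc_right[OF this]
  obtain e where e: "e > 0" "\<And>h. h > 0 \<Longrightarrow> \<alpha> + h \<in> {\<alpha>..\<beta>} \<Longrightarrow> h < e \<Longrightarrow> 0 < u (\<alpha> + h)"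
    using jacobi_onD(3)[OF u] by auto
  have near: "0 < u x" if "\<alpha> < x" "x < \<alpha> + e" "x < \<beta>" for x
    using e(2)[of "x - \<alpha>"] that by simp
  define Z where "Z = {x \<in> {\<alpha> + e..t}. u x \<le> 0}"
  have "continuous_on {\<alpha> + e..t} u"
    by (rule continuous_on_subset[OF cu]) (use e(1) t in auto)
  then have "closed Z"
    unfolding Z_def by (intro continuous_on_closed_Collect_le) simp_all
  moreover have "bounded Z"
    by (rule bounded_subset[of "{\<alpha> + e..t}"]) (auto simp: Z_def)
  ultimately have "compact Z"
    by (simp add: compact_eq_bounded_closed)
  moreover have "t \<in> Z"
    using neg near[of t] t unfolding Z_def by (cases "t < \<alpha> + e") simp_all
  ultimately obtain \<tau> where \<tau>: "\<tau> \<in> Z" "\<And>x. x \<in> Z \<Longrightarrow> \<tau> \<le> x"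
    using compact_attains_inf[of Z] by auto
  have \<tau>': "\<alpha> < \<tau>" "\<tau> < \<beta>" "\<tau> \<le> t" "u \<tau> \<le> 0"
    using \<tau>(1) e(1) t by (auto simp: Z_def)
  have before: "0 < u x" if "\<alpha> < x" "x < \<tau>" for x
  proof (rule ccontr)
    assume "\<not> 0 < u x"
    then have "x \<in> Z"
      using that near[of x] \<tau>' unfolding Z_def by (cases "x < \<alpha> + e") simp_all
    from \<tau>(2)[OF this] that show False by simp
  qed
  have "0 \<le> u \<tau> - v \<tau>"
  proof (rule continuous_ge_on_Ioo[of \<alpha> \<tau> "\<lambda>x. u x - v x" 0 \<tau>])
    show "continuous_on {\<alpha>..\<tau>} (\<lambda>x. u x - v x)"
      by (rule continuous_on_subset[OF continuous_on_diff[OF cu cv]]) (use \<tau>' in simp)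
    have "v x \<le> u x" if "x \<in> {\<alpha><..<\<tau>}" for x
      by (rule jacobi_comparison_of_pos[OF jacobi_on_subinterval[OF u] jacobi_on_subinterval[OF v]
            _ _ _ that]) (use before vpos pq \<tau>'(2) in auto)
    then show "0 \<le> u x - v x" if "x \<in> {\<alpha><..<\<tau>}" for x
      using that by simp
  qed (use \<tau>' in simp_all)
  moreover have "0 < v \<tau>" using bspec[OF vpos, of \<tau>] \<tau>' by simp
  ultimately show False using \<tau>' by simp
qed

theorem sturm_comparison:
  assumes u: "jacobi_on \<alpha> \<beta> p u u'" and v: "jacobi_on \<alpha> \<beta> q v v'"
    and vpos: "\<forall>t\<in>{\<alpha><..<\<beta>}. 0 < v t" and pq: "\<forall>t\<in>{\<alpha><..<\<beta>}. p t \<le> q t"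
    and t: "t \<in> {\<alpha><..<\<beta>}"
  shows "v t \<le> u t"
  by (rule jacobi_comparison_of_pos[OF u v sturm_positivity[OF u v vpos pq] vpos pq t])

text \<open>If \<open>u\<close> and \<open>v\<close> meet again at \<open>t\<close>, then the nondecreasing quotient \<open>u / v\<close>, which starts at
  \<open>1\<close>, is \<open>1\<close> up to \<open>t\<close>; two solutions that agree there have the same coefficient.\<close>

theorem sturm_rigidity:
  assumes u: "jacobi_on \<alpha> \<beta> p u u'" and v: "jacobi_on \<alpha> \<beta> q v v'"
    and vpos: "\<forall>t\<in>{\<alpha><..<\<beta>}. 0 < v t" and pq: "\<forall>t\<in>{\<alpha><..<\<beta>}. p t \<le> q t"
    and meet: "u t = v t" and st: "\<alpha> < s" "s < t" "t < \<beta>"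
  shows "p s = q s"
proof -
  have sub: "x \<in> {\<alpha><..<\<beta>}" if "x \<in> {\<alpha><..<t}" for x using that st by simp
  have s: "s \<in> {\<alpha><..<t}" using st by simp
  have eq: "v x = u x" if x: "x \<in> {\<alpha><..<t}" for x
  proof -
    have "u x / v x \<le> u t / v t"
      by (rule jacobi_quotient_nondecreasing[OF u v sturm_positivity[OF u v vpos pq] vpos pq])
         (use x st in simp_all)
    also have "u t / v t = 1"
      using bspec[OF vpos, of t] meet st by simp
    finally have "u x \<le> v x"
      using bspec[OF vpos sub[OF x]] by (simp add: field_simps)
    with sturm_comparison[OF u v vpos pq sub[OF x]] show ?thesis by simp
  qed
  have eq': "v' x = u' x" if x: "x \<in> {\<alpha><..<t}" for x
  proof (rule DERIV_unique)
    show "(u has_real_derivative u' x) (at x)"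
      by (rule derivative_at_interior_Icc[OF jacobi_onD(1)[OF u] sub[OF x]])
    show "(u has_real_derivative v' x) (at x)"
      by (rule has_field_derivative_transform_within_open
            [OF derivative_at_interior_Icc[OF jacobi_onD(1)[OF v] sub[OF x]] _ x])
         (simp_all add: eq)
  qed
  have "- p s * u s = - q s * v s"
  proof (rule DERIV_unique)
    show "(u' has_real_derivative - p s * u s) (at s)"
      by (rule derivative_at_interior_Icc[OF jacobi_onD(2)[OF u] sub[OF s]])
    show "(u' has_real_derivative - q s * v s) (at s)"
      by (rule has_field_derivative_transform_within_open
            [OF derivative_at_interior_Icc[OF jacobi_onD(2)[OF v] sub[OF s]] _ s])
         (simp_all add: eq')
  qed
  then show ?thesis
    using eq[OF s] bspec[OF vpos sub[OF s]] by simp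
qed

section \<open>The curves of constant affine curvature\<close>

text \<open>\<open>cosbar k\<close> is the derivative of \<open>xbar k\<close>, and \<open>zbar k\<close> is the antiderivative of \<open>ybar k\<close> that
  vanishes at \<open>0\<close>.\<close>

definition cosbar :: "real \<Rightarrow> real \<Rightarrow> real" where
  "cosbar k s = (if k > 0 then cos (sqrt k * s) else if k = 0 then 1 else cosh (sqrt \<bar>k\<bar> * s))"

definition zbar :: "real \<Rightarrow> real \<Rightarrow> real" where
  "zbar k s = (if k = 0 then s ^ 3 / 6 else (s - xbar k s) / k)"

text \<open>Naming the square root of \<open>\<bar>k\<bar>\<close> keeps \<open>sqrt\<close> out of the computations below.\<close>

lemma curvature_cases:
  fixes k :: real
  obtains (parabolic) "k = 0" | (elliptic) w where "0 < w" "k = w\<^sup>2"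
    | (hyperbolic) w where "0 < w" "k = - w\<^sup>2"
proof (cases k "0 :: real" rule: linorder_cases)
  case less
  then show thesis by (intro hyperbolic[of "sqrt (- k)"]) simp_all
next
  case greater
  then show thesis by (intro elliptic[of "sqrt k"]) simp_all
qed (rule parabolic)

lemma bar_elliptic:
  assumes "0 < w"
  shows "xbar (w\<^sup>2) = (\<lambda>s. sin (w * s) / w)" and "ybar (w\<^sup>2) = (\<lambda>s. (1 - cos (w * s)) / w\<^sup>2)"
    and "cosbar (w\<^sup>2) = (\<lambda>s. cos (w * s))"
    and "zbar (w\<^sup>2) = (\<lambda>s. (s - sin (w * s) / w) / w\<^sup>2)"
  using assms by (simp_all add: fun_eq_iff xbar_def ybar_def cosbar_def zbar_def)

lemma bar_hyperbolic:
  assumes "0 < w"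
  shows "xbar (- w\<^sup>2) = (\<lambda>s. sinh (w * s) / w)"
    and "ybar (- w\<^sup>2) = (\<lambda>s. (cosh (w * s) - 1) / w\<^sup>2)"
    and "cosbar (- w\<^sup>2) = (\<lambda>s. cosh (w * s))"
    and "zbar (- w\<^sup>2) = (\<lambda>s. (sinh (w * s) / w - s) / w\<^sup>2)"
proof -
  have "\<not> 0 < - w\<^sup>2" using zero_le_power2[of w] by linarith
  then show "xbar (- w\<^sup>2) = (\<lambda>s. sinh (w * s) / w)"
    "ybar (- w\<^sup>2) = (\<lambda>s. (cosh (w * s) - 1) / w\<^sup>2)"
    "cosbar (- w\<^sup>2) = (\<lambda>s. cosh (w * s))"
    "zbar (- w\<^sup>2) = (\<lambda>s. (sinh (w * s) / w - s) / w\<^sup>2)"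
    using assms by (simp_all add: fun_eq_iff xbar_def ybar_def cosbar_def zbar_def divide_simps)
qed

lemma bar_parabolic:
  "xbar 0 = (\<lambda>s. s)" "ybar 0 = (\<lambda>s. s\<^sup>2 / 2)" "cosbar 0 = (\<lambda>s. 1)" "zbar 0 = (\<lambda>s. s ^ 3 / 6)"
  by (simp_all add: fun_eq_iff xbar_def ybar_def cosbar_def zbar_def)

lemma has_derivative_bar:
  shows has_derivative_cosbar: "(cosbar k has_real_derivative - k * xbar k s) (at s)"
    and has_derivative_xbar: "(xbar k has_real_derivative cosbar k s) (at s)"
    and has_derivative_ybar: "(ybar k has_real_derivative xbar k s) (at s)"
    and has_derivative_zbar: "(zbar k has_real_derivative ybar k s) (at s)"
proof -
  have "(cosbar k has_real_derivative - k * xbar k s) (at s) \<and>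
    (xbar k has_real_derivative cosbar k s) (at s) \<and>
    (ybar k has_real_derivative xbar k s) (at s) \<and>
    (zbar k has_real_derivative ybar k s) (at s)"
  proof (cases k rule: curvature_cases)
    case parabolic
    then show ?thesis by (auto simp: bar_parabolic intro!: derivative_eq_intros)
  next
    case (elliptic w)
    show ?thesis
      unfolding elliptic(2) bar_elliptic[OF elliptic(1)] using elliptic(1)
      by (auto intro!: derivative_eq_intros simp: field_simps power2_eq_square)
  next
    case (hyperbolic w)
    show ?thesis
      unfolding hyperbolic(2) bar_hyperbolic[OF hyperbolic(1)] using hyperbolic(1)
      by (auto intro!: derivative_eq_intros simp: field_simps power2_eq_square)
  qed
  then show "(cosbar k has_real_derivative - k * xbar k s) (at s)"
    "(xbar k has_real_derivative cosbar k s) (at s)"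
    "(ybar k has_real_derivative xbar k s) (at s)"
    "(zbar k has_real_derivative ybar k s) (at s)"
    by blast+
qed

lemmas bar_derivative_intros [derivative_intros] =
  has_derivative_cosbar[THEN DERIV_chain2] has_derivative_xbar[THEN DERIV_chain2]
  has_derivative_ybar[THEN DERIV_chain2] has_derivative_zbar[THEN DERIV_chain2]

lemma bar_0 [simp]: "xbar k 0 = 0" "cosbar k 0 = 1" "ybar k 0 = 0" "zbar k 0 = 0"
  by (simp_all add: xbar_def cosbar_def ybar_def zbar_def)

lemma jacobi_on_xbar:
  "jacobi_on \<alpha> \<beta> (\<lambda>_. k) (\<lambda>t. xbar k (t - \<alpha>)) (\<lambda>t. cosbar k (t - \<alpha>))"
  unfolding jacobi_on_def by (auto intro!: derivative_eq_intros)

text \<open>For \<open>k > 0\<close> the first positive zero of \<open>xbar k\<close> is \<open>\<pi> / sqrt k \<ge> \<Lambda>\<close>; otherwise there is none.\<close>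

lemma xbar_pos:
  assumes k: "k \<le> (pi / \<Lambda>)\<^sup>2" and s: "0 < s" "s < \<Lambda>"
  shows "0 < xbar k s"
proof (cases "k > 0")
  case True
  have "sqrt k \<le> pi / \<Lambda>"
    using k s by (intro real_le_lsqrt) simp_all
  then have "sqrt k * s \<le> pi / \<Lambda> * s" using s by (intro mult_right_mono) simp_all
  also have "\<dots> < pi" using s by (simp add: field_simps)
  finally show ?thesis
    using True s by (auto simp: xbar_def intro!: divide_pos_pos sin_gt_zero)
next
  case False
  then show ?thesis using s by (auto simp: xbar_def)
qed

text \<open>Twice the area of the triangle cut out by three points of the model curve, with \<open>u\<close> and \<open>v\<close> the
  affine lengths of the two arcs between them.\<close>

definition model_area :: "real \<Rightarrow> real \<Rightarrow> real \<Rightarrow> real" where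
  "model_area k u v = zbar k (u + v) - zbar k u - zbar k v"

lemma model_area_diagonal: "model_area k l l = 2 * (xbar k l * ybar k l)"
proof (cases k rule: curvature_cases)
  case parabolic
  then show ?thesis
    by (simp add: model_area_def bar_parabolic power2_eq_square power3_eq_cube)
next
  case (elliptic w)
  have "sin (w * (l + l)) = 2 * sin (w * l) * cos (w * l)"
    using sin_double[of "w * l"] by (simp add: algebra_simps)
  then show ?thesis
    unfolding model_area_def elliptic(2) bar_elliptic[OF elliptic(1)] using elliptic(1)
    by (simp add: field_simps)
next
  case (hyperbolic w)
  have "sinh (w * (l + l)) = 2 * sinh (w * l) * cosh (w * l)"
    using sinh_double[of "w * l"] by (simp add: algebra_simps)
  then show ?thesis
    unfolding model_area_def hyperbolic(2) bar_hyperbolic[OF hyperbolic(1)] using hyperbolic(1)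
    by (simp add: field_simps)
qed

text \<open>As \<open>xbar k\<close> is positive between \<open>0\<close> and \<open>\<Lambda>\<close>, \<open>ybar\<close> increases and \<open>zbar\<close> is strictly convex. Hence the model area
  grows with the second arc, and among pairs of arcs of total length \<open>\<Lambda>\<close> the equal pair is the
  best, because it minimizes \<open>zbar k u + zbar k (\<Lambda> - u)\<close>.\<close>

context
  fixes k \<Lambda> :: real
  assumes k: "k \<le> (pi / \<Lambda>)\<^sup>2"
begin

lemma ybar_strict_mono:
  assumes "0 \<le> s" "s < t" "t \<le> \<Lambda>"
  shows "ybar k s < ybar k t"
proof (rule DERIV_pos_imp_increasing_open[OF \<open>s < t\<close>])
  show "\<exists>y. (ybar k has_real_derivative y) (at x) \<and> 0 < y" if "s < x" "x < t" for x
    using has_derivative_ybar xbar_pos[OF k, of x] that assms by auto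
  show "continuous_on {s..t} (ybar k)"
    by (rule DERIV_continuous_on) (rule has_derivative_ybar[THEN has_field_derivative_at_within])
qed

lemma model_area_less_extend:
  assumes "0 < u" "0 < v" "v < w" "u + w \<le> \<Lambda>"
  shows "model_area k u v < model_area k u w"
proof -
  have "zbar k (u + v) - zbar k v < zbar k (u + w) - zbar k w"
  proof (rule DERIV_pos_imp_increasing[OF \<open>v < w\<close>])
    fix x assume x: "v \<le> x" "x \<le> w"
    have "((\<lambda>v. zbar k (u + v) - zbar k v) has_real_derivative ybar k (u + x) - ybar k x) (at x)"
      by (auto intro!: derivative_eq_intros)
    moreover have "ybar k x < ybar k (u + x)"
      using x assms by (intro ybar_strict_mono) auto
    ultimately show "\<exists>y. ((\<lambda>v. zbar k (u + v) - zbar k v) has_real_derivative y) (at x) \<and> 0 < y"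
      by auto
  qed
  then show ?thesis by (simp add: model_area_def)
qed

lemma model_area_less_balanced:
  assumes "0 < u" "u < \<Lambda> / 2"
  shows "model_area k u (\<Lambda> - u) < model_area k (\<Lambda> / 2) (\<Lambda> / 2)"
proof -
  have "zbar k u + zbar k (\<Lambda> - u) > zbar k (\<Lambda> / 2) + zbar k (\<Lambda> - \<Lambda> / 2)"
  proof (rule DERIV_neg_imp_decreasing_open[OF assms(2)])
    fix x assume x: "u < x" "x < \<Lambda> / 2"
    have "((\<lambda>u. zbar k u + zbar k (\<Lambda> - u)) has_real_derivative ybar k x - ybar k (\<Lambda> - x)) (at x)"
      by (auto intro!: derivative_eq_intros)
    moreover have "ybar k x < ybar k (\<Lambda> - x)"
      using x assms by (intro ybar_strict_mono) auto
    ultimately show "\<exists>y. ((\<lambda>u. zbar k u + zbar k (\<Lambda> - u)) has_real_derivative y) (at x) \<and> y < 0"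
      by auto
  next
    have c: "continuous_on S (zbar k)" for S
      by (rule DERIV_continuous_on) (rule has_derivative_zbar[THEN has_field_derivative_at_within])
    show "continuous_on {u..\<Lambda> / 2} (\<lambda>u. zbar k u + zbar k (\<Lambda> - u))"
      by (intro continuous_intros continuous_on_compose2[OF c[of UNIV]]) auto
  qed
  then show ?thesis by (simp add: model_area_def)
qed

lemma model_area_le_balanced:
  assumes "0 < u" "0 < v" "u + v \<le> \<Lambda>"
  shows "model_area k u v \<le> model_area k (\<Lambda> / 2) (\<Lambda> / 2)"
    and "model_area k u v = model_area k (\<Lambda> / 2) (\<Lambda> / 2) \<Longrightarrow> u = \<Lambda> / 2 \<and> v = \<Lambda> / 2"
proof -
  have sym: "model_area k x y = model_area k y x" for x y
    by (simp add: model_area_def add.commute)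
  have bal: "model_area k u (\<Lambda> - u) < model_area k (\<Lambda> / 2) (\<Lambda> / 2) \<or> u = \<Lambda> / 2"
    using model_area_less_balanced[of u] model_area_less_balanced[of "\<Lambda> - u"] assms
    by (cases u "\<Lambda> / 2" rule: linorder_cases) (auto simp: sym)
  have ext: "model_area k u v < model_area k u (\<Lambda> - u) \<or> v = \<Lambda> - u"
    using model_area_less_extend[of u v "\<Lambda> - u"] assms by fastforce
  have half: "\<Lambda> - \<Lambda> / 2 = \<Lambda> / 2" by simp
  show "model_area k u v \<le> model_area k (\<Lambda> / 2) (\<Lambda> / 2)"
    using bal ext half by (metis less_eq_real_def order.strict_trans)
  show "u = \<Lambda> / 2 \<and> v = \<Lambda> / 2"
    if "model_area k u v = model_area k (\<Lambda> / 2) (\<Lambda> / 2)"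
    using bal ext half that by (metis less_irrefl order.strict_trans)
qed

end

section \<open>Curves of affine unit speed\<close>

lemma wedge_has_derivative:
  assumes "(f has_vector_derivative f') (at t within S)"
  shows wedge_has_derivative_right: "((\<lambda>t. wedge v (f t)) has_real_derivative wedge v f') (at t within S)"
    and wedge_has_derivative_left: "((\<lambda>t. wedge (f t) v) has_real_derivative wedge f' v) (at t within S)"
proof -
  have nth: "((\<lambda>t. f t $ i) has_real_derivative f' $ i) (at t within S)" for i
    using bounded_linear.has_vector_derivative[OF bounded_linear_vec_nth assms, of i]
    by (simp add: has_real_derivative_iff_has_vector_derivative)
  show "((\<lambda>t. wedge v (f t)) has_real_derivative wedge v f') (at t within S)"
    "((\<lambda>t. wedge (f t) v) has_real_derivative wedge f' v) (at t within S)"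
    unfolding wedge_def by (intro DERIV_diff DERIV_cmult DERIV_cmult_right nth)+
qed

lemma triangle_area_eq_wedge: "triangle_area p q r = \<bar>wedge (q - p) (r - q)\<bar> / 2"
proof -
  have "convex hull {p, q, r} \<in> sets borel"
    by (intro borel_compact finite_imp_compact_convex_hull) simp
  then have "triangle_area p q r = measure lborel (convex hull {p, q, r})"
    by (simp add: triangle_area_def)
  then show ?thesis
    by (simp add: content_triangle wedge_def algebra_simps abs_minus_commute)
qed

text \<open>The derivatives \<open>c1\<close>, \<open>c2\<close> and the curvature \<open>\<kappa>\<close> are parameters, characterized by the relations
  between them, so that neither the choice of a vector derivative nor the description operator in
  \<open>affine_curvature\<close> enters the argument.\<close>

locale affine_curve =
  fixes \<Lambda> :: real and c c1 c2 :: "real \<Rightarrow> real^2" and \<kappa> :: "real \<Rightarrow> real"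
  assumes d0: "t \<in> {0..\<Lambda>} \<Longrightarrow> (c has_vector_derivative c1 t) (at t within {0..\<Lambda>})"
    and d1: "t \<in> {0..\<Lambda>} \<Longrightarrow> (c1 has_vector_derivative c2 t) (at t within {0..\<Lambda>})"
    and d2: "t \<in> {0..\<Lambda>} \<Longrightarrow> (c2 has_vector_derivative - \<kappa> t *\<^sub>R c1 t) (at t within {0..\<Lambda>})"
    and unit: "t \<in> {0..\<Lambda>} \<Longrightarrow> wedge (c1 t) (c2 t) = 1"
begin

lemma jacobi_on_wedge:
  assumes s: "s \<in> {0..\<Lambda>}"
  shows "jacobi_on s \<Lambda> \<kappa> (\<lambda>t. wedge (c1 s) (c1 t)) (\<lambda>t. wedge (c1 s) (c2 t))"
  unfolding jacobi_on_def
proof (intro conjI ballI)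
  fix t assume t: "t \<in> {s..\<Lambda>}"
  have sub: "{s..\<Lambda>} \<subseteq> {0..\<Lambda>}" and t': "t \<in> {0..\<Lambda>}" using s t by auto
  show "((\<lambda>t. wedge (c1 s) (c1 t)) has_real_derivative wedge (c1 s) (c2 t)) (at t within {s..\<Lambda>})"
    by (rule DERIV_subset[OF wedge_has_derivative_right[OF d1[OF t']] sub])
  have "wedge (c1 s) (- \<kappa> t *\<^sub>R c1 t) = - \<kappa> t * wedge (c1 s) (c1 t)"
    by (simp add: wedge_def algebra_simps)
  then show "((\<lambda>t. wedge (c1 s) (c2 t)) has_real_derivative - \<kappa> t * wedge (c1 s) (c1 t))
      (at t within {s..\<Lambda>})"
    using DERIV_subset[OF wedge_has_derivative_right[OF d2[OF t'], of "c1 s"] sub] by simp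
qed (use unit[OF s] in \<open>simp_all add: wedge_def\<close>)

text \<open>Twice the oriented area of the triangle is the mixed difference of \<open>wedge (c s) (c t)\<close> over a
  rectangle on which \<open>s \<le> t\<close>, and the model area is that of \<open>- zbar k (t - s)\<close>. The coefficients
  \<open>A\<close>, \<open>B\<close> allow for comparing the two in either direction, as well as for determining the sign.\<close>

lemma triangle_mixed_difference:
  assumes abd: "0 \<le> a" "a \<le> b" "b \<le> d" "d \<le> \<Lambda>"
    and nn: "\<And>s t. s \<in> {a<..<b} \<Longrightarrow> t \<in> {b<..<d} \<Longrightarrow> 0 \<le> A * wedge (c1 s) (c1 t) + B * xbar k (t - s)"
  shows triangle_mixed_difference_nonneg:
      "0 \<le> A * wedge (c b - c a) (c d - c b) + B * model_area k (b - a) (d - b)"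
    and triangle_mixed_difference_rigid:
      "A * wedge (c b - c a) (c d - c b) + B * model_area k (b - a) (d - b) = 0 \<Longrightarrow>
        s \<in> {a<..<b} \<Longrightarrow> t \<in> {b<..<d} \<Longrightarrow> A * wedge (c1 s) (c1 t) + B * xbar k (t - s) = 0"
proof -
  define h where "h = (\<lambda>s t. A * wedge (c s) (c t) + B * - zbar k (t - s))"
  define h1 where "h1 = (\<lambda>s t. A * wedge (c1 s) (c t) + B * ybar k (t - s))"
  define h12 where "h12 = (\<lambda>s t. A * wedge (c1 s) (c1 t) + B * xbar k (t - s))"
  have D1: "\<forall>s\<in>{a..b}. ((\<lambda>s. h s t) has_real_derivative h1 s t) (at s within {a..b})" for t
  proof
    fix s assume s: "s \<in> {a..b}"
    have "((\<lambda>s. wedge (c s) (c t)) has_real_derivative wedge (c1 s) (c t)) (at s within {a..b})"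
      by (rule DERIV_subset[OF wedge_has_derivative_left[OF d0]]) (use s abd in auto)
    moreover have "((\<lambda>s. - zbar k (t - s)) has_real_derivative ybar k (t - s)) (at s within {a..b})"
      by (auto intro!: derivative_eq_intros)
    ultimately show "((\<lambda>s. h s t) has_real_derivative h1 s t) (at s within {a..b})"
      unfolding h_def h1_def by (intro DERIV_add DERIV_cmult)
  qed
  have D2: "\<forall>t\<in>{b..d}. (h1 s has_real_derivative h12 s t) (at t within {b..d})" for s
  proof
    fix t assume t: "t \<in> {b..d}"
    have "((\<lambda>t. wedge (c1 s) (c t)) has_real_derivative wedge (c1 s) (c1 t)) (at t within {b..d})"
      by (rule DERIV_subset[OF wedge_has_derivative_right[OF d0]]) (use t abd in auto)
    moreover have "((\<lambda>t. ybar k (t - s)) has_real_derivative xbar k (t - s)) (at t within {b..d})"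
      by (auto intro!: derivative_eq_intros)
    ultimately show "(h1 s has_real_derivative h12 s t) (at t within {b..d})"
      unfolding h1_def h12_def by (intro DERIV_add DERIV_cmult)
  qed
  have N: "0 \<le> h12 s t" if "s \<in> {a<..<b}" "t \<in> {b<..<d}" for s t
    using nn[OF that] by (simp add: h12_def)
  have eq: "h b d - h b b - h a d + h a b =
      A * wedge (c b - c a) (c d - c b) + B * model_area k (b - a) (d - b)"
    by (simp add: h_def model_area_def wedge_def algebra_simps)
  show "0 \<le> A * wedge (c b - c a) (c d - c b) + B * model_area k (b - a) (d - b)"
    using mixed_difference_nonneg[OF D1 D2 N abd(2,3)] unfolding eq .
  show "A * wedge (c1 s) (c1 t) + B * xbar k (t - s) = 0"
    if "A * wedge (c b - c a) (c d - c b) + B * model_area k (b - a) (d - b) = 0"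
      "s \<in> {a<..<b}" "t \<in> {b<..<d}"
    using mixed_difference_rigid[OF D1 D2 N abd(2,3)] that unfolding eq h12_def by blast
qed

end

locale affine_curve_bounded = affine_curve +
  fixes k :: real
  assumes length_pos: "0 < \<Lambda>"
    and lower: "t \<in> {0..\<Lambda>} \<Longrightarrow> k \<le> \<kappa> t"
    and upper: "t \<in> {0..\<Lambda>} \<Longrightarrow> \<kappa> t \<le> (pi / \<Lambda>)\<^sup>2"
begin

lemma k_le: "k \<le> (pi / \<Lambda>)\<^sup>2"
  using lower[of 0] upper[of 0] length_pos by simp

text \<open>The comparison function has the constant curvature \<open>(\<pi> / \<Lambda>)\<^sup>2\<close>: it is the sine arch
  whose second zero lies at distance exactly \<open>\<Lambda>\<close>.\<close>

lemma wedge_tangents_pos: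
  assumes "s \<in> {0..\<Lambda>}"
  shows "\<forall>t\<in>{s<..<\<Lambda>}. 0 < wedge (c1 s) (c1 t)"
  by (rule sturm_positivity[OF jacobi_on_wedge[OF assms] jacobi_on_xbar[of _ _ "(pi / \<Lambda>)\<^sup>2"]])
     (use assms in \<open>auto intro!: xbar_pos[of _ \<Lambda>] upper\<close>)

lemma wedge_tangents_le:
  assumes "s \<in> {0..\<Lambda>}" "t \<in> {s<..<\<Lambda>}"
  shows "wedge (c1 s) (c1 t) \<le> xbar k (t - s)"
  by (rule sturm_comparison[OF jacobi_on_xbar jacobi_on_wedge[OF assms(1)]
        wedge_tangents_pos[OF assms(1)] _ assms(2)])
     (use assms in \<open>auto intro!: lower\<close>)

lemma wedge_tangents_eq:
  assumes "\<forall>t\<in>{0..\<Lambda>}. \<kappa> t = k" "s \<in> {0..\<Lambda>}" "t \<in> {s<..<\<Lambda>}"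
  shows "wedge (c1 s) (c1 t) = xbar k (t - s)"
proof (rule antisym[OF wedge_tangents_le[OF assms(2,3)]])
  show "xbar k (t - s) \<le> wedge (c1 s) (c1 t)"
    by (rule sturm_comparison[OF jacobi_on_wedge[OF assms(2)] jacobi_on_xbar _ _ assms(3)])
       (use assms in \<open>auto intro!: xbar_pos[OF k_le]\<close>)
qed

context
  fixes a b d :: real
  assumes abd: "0 \<le> a" "a < b" "b < d" "d \<le> \<Lambda>"
begin

lemma triangle_area_eq_signed: "triangle_area (c a) (c b) (c d) = wedge (c b - c a) (c d - c b) / 2"
proof -
  have "0 \<le> 1 * wedge (c b - c a) (c d - c b) + 0 * model_area k (b - a) (d - b)"
  proof (rule triangle_mixed_difference_nonneg)
    fix s t assume st: "s \<in> {a<..<b}" "t \<in> {b<..<d}"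
    have "0 < wedge (c1 s) (c1 t)"
      by (rule bspec[OF wedge_tangents_pos]) (use st abd in auto)
    then show "0 \<le> 1 * wedge (c1 s) (c1 t) + 0 * xbar k (t - s)" by simp
  qed (use abd in auto)
  then show ?thesis by (simp add: triangle_area_eq_wedge)
qed

lemma wedge_defect_nonneg:
  assumes "s \<in> {a<..<b}" "t \<in> {b<..<d}"
  shows "0 \<le> - 1 * wedge (c1 s) (c1 t) + 1 * xbar k (t - s)"
  using wedge_tangents_le[of s t] assms abd by simp

lemma triangle_area_le_model: "triangle_area (c a) (c b) (c d) \<le> model_area k (b - a) (d - b) / 2"
  using triangle_mixed_difference_nonneg[OF _ _ _ _ wedge_defect_nonneg] abd
  by (simp add: triangle_area_eq_signed)

text \<open>Equality of the areas forces equality in the comparison of \<open>wedge (c1 s) (c1 t)\<close> with \<open>xbar\<close> for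
  all \<open>s\<close> between \<open>a\<close> and \<open>b\<close> and \<open>t\<close> between \<open>b\<close> and \<open>d\<close>, so that the curvature is \<open>k\<close> between
  any such \<open>s\<close> and \<open>t\<close>.\<close>

lemma curvature_eq_of_area_eq:
  assumes eq: "triangle_area (c a) (c b) (c d) = model_area k (b - a) (d - b) / 2"
    and r: "r \<in> {a<..<d}"
  shows "\<kappa> r = k"
proof -
  obtain s where s: "a < s" "s < b" "s < r"
    using dense[of a "min b r"] r abd by auto
  obtain t where t: "b < t" "t < d" "r < t"
    using dense[of "max b r" d] r abd by auto
  have "- 1 * wedge (c1 s) (c1 t) + 1 * xbar k (t - s) = 0"
    by (rule triangle_mixed_difference_rigid[OF _ _ _ _ wedge_defect_nonneg])
       (use abd s t eq in \<open>simp_all add: triangle_area_eq_signed\<close>)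
  then have meet: "xbar k (t - s) = wedge (c1 s) (c1 t)" by simp
  have s': "s \<in> {0..\<Lambda>}" using s abd by simp
  have "k = \<kappa> r"
    by (rule sturm_rigidity[OF jacobi_on_xbar jacobi_on_wedge[OF s'] wedge_tangents_pos[OF s'] _ meet])
       (use s t s' abd in \<open>auto intro!: lower\<close>)
  then show ?thesis by simp
qed

lemma triangle_area_eq_model:
  assumes "\<forall>t\<in>{0..\<Lambda>}. \<kappa> t = k"
  shows "triangle_area (c a) (c b) (c d) = model_area k (b - a) (d - b) / 2"
proof -
  have "0 \<le> 1 * wedge (c b - c a) (c d - c b) + (- 1) * model_area k (b - a) (d - b)"
  proof (rule triangle_mixed_difference_nonneg)
    fix s t assume "s \<in> {a<..<b}" "t \<in> {b<..<d}"
    then show "0 \<le> 1 * wedge (c1 s) (c1 t) + (- 1) * xbar k (t - s)"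
      using wedge_tangents_eq[OF assms, of s t] abd by simp
  qed (use abd in auto)
  then show ?thesis
    using triangle_area_le_model by (simp add: triangle_area_eq_signed)
qed

end

end

lemma affine_curvature_eq_wedge:
  assumes "affine_unit_speed_param \<C> \<Lambda> c" "t \<in> {0..\<Lambda>}"
  defines "D \<equiv> deriv_on {0..\<Lambda>}"
  shows "affine_curvature {0..\<Lambda>} c t = - wedge (D (D (D c)) t) (D (D c) t)"
proof -
  have "wedge (D c t) (D (D c) t) = 1"
    using assms by (simp add: affine_unit_speed_param_def affine_unit_speed_on_def)
  moreover have "wedge (- x *\<^sub>R v) w = - x * wedge v w" for x v w
    by (simp add: wedge_def algebra_simps)
  ultimately show ?thesis
    using affine_curvature[OF assms(1,2)] by (simp add: D_def)
qed

text \<open>The equality case determines the curvature in the open parameter interval only; continuity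
  carries it over to the endpoints.\<close>

lemma continuous_on_affine_curvature:
  assumes "affine_unit_speed_param \<C> \<Lambda> c"
  shows "continuous_on {0..\<Lambda>} (affine_curvature {0..\<Lambda>} c)"
proof -
  define D where "D = deriv_on {0..\<Lambda>}"
  have "continuous_on {0..\<Lambda>} (D (D (D c)))" "continuous_on {0..\<Lambda>} (D (D c))"
    using assms unfolding affine_unit_speed_param_def C3_curve_on_def D_def
    by (auto intro: differentiable_imp_continuous_on)
  then have "continuous_on {0..\<Lambda>} (\<lambda>t. - wedge (D (D (D c)) t) (D (D c) t))"
    unfolding wedge_def by (intro continuous_intros)
  then show ?thesis
    by (rule continuous_on_eq) (simp add: affine_curvature_eq_wedge[OF assms] D_def)
qed

lemma affine_curve_of_param:
  assumes "affine_unit_speed_param \<C> \<Lambda> c"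
  defines "D \<equiv> deriv_on {0..\<Lambda>}"
  shows "affine_curve \<Lambda> c (D c) (D (D c)) (affine_curvature {0..\<Lambda>} c)"
proof
  have C: "c differentiable_on {0..\<Lambda>}" "D c differentiable_on {0..\<Lambda>}"
    "D (D c) differentiable_on {0..\<Lambda>}"
    using assms by (auto simp: affine_unit_speed_param_def C3_curve_on_def)
  fix t assume t: "t \<in> {0..\<Lambda>}"
  show "(c has_vector_derivative D c t) (at t within {0..\<Lambda>})"
    "(D c has_vector_derivative D (D c) t) (at t within {0..\<Lambda>})"
    unfolding D_def using has_vector_derivative_deriv_on[OF C(1) t]
      has_vector_derivative_deriv_on[OF C(2) t] by (simp_all add: D_def)
  show "(D (D c) has_vector_derivative - affine_curvature {0..\<Lambda>} c t *\<^sub>R D c t) (at t within {0..\<Lambda>})"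
    using has_vector_derivative_deriv_on[OF C(3) t] affine_curvature[OF assms(1) t]
    by (simp add: D_def)
  show "wedge (D c t) (D (D c) t) = 1"
    using assms t by (simp add: affine_unit_speed_param_def affine_unit_speed_on_def)
qed

lemma obtain_sorted_parameters:
  fixes c :: "real \<Rightarrow> 'a"
  assumes "p \<in> c ` S" "q \<in> c ` S" "r \<in> c ` S" "p \<noteq> q" "p \<noteq> r" "q \<noteq> r"
  obtains x y z where "x \<in> S" "y \<in> S" "z \<in> S" "x < y" "y < z" "{p, q, r} = {c x, c y, c z}"
proof -
  obtain x y z where xyz: "x \<in> S" "y \<in> S" "z \<in> S" "p = c x" "q = c y" "r = c z"
    using assms(1-3) by blast
  then have "x \<noteq> y" "x \<noteq> z" "y \<noteq> z" using assms(4-6) by auto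
  then consider "x < y" "y < z" | "x < z" "z < y" | "y < x" "x < z" | "y < z" "z < x"
    | "z < x" "x < y" | "z < y" "y < x" by linarith
  then show thesis
  proof cases
    case 1 then show thesis by (intro that[of x y z]) (auto simp: xyz)
  next
    case 2 then show thesis by (intro that[of x z y]) (auto simp: xyz)
  next
    case 3 then show thesis by (intro that[of y x z]) (auto simp: xyz)
  next
    case 4 then show thesis by (intro that[of y z x]) (auto simp: xyz)
  next
    case 5 then show thesis by (intro that[of z x y]) (auto simp: xyz)
  next
    case 6 then show thesis by (intro that[of z y x]) (auto simp: xyz)
  qed
qed

theorem theorem5p8:
  fixes \<C> :: "(real^2) set" and c :: "real \<Rightarrow> real^2" and \<Lambda> k\<^sub>0 k\<^sub>1 L :: real
    and p\<^sub>1 p\<^sub>2 p\<^sub>3 :: "real^2"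
  assumes "convex_arc \<C>"
    and "affine_unit_speed_param \<C> \<Lambda> c"
    and "\<forall>s\<in>{0..\<Lambda>}. k\<^sub>0 \<le> affine_curvature {0..\<Lambda>} c s \<and> affine_curvature {0..\<Lambda>} c s \<le> k\<^sub>1"
    and "k\<^sub>1 \<le> (pi / \<Lambda>)\<^sup>2"
    and "p\<^sub>1 \<in> \<C>" and "p\<^sub>2 \<in> \<C>" and "p\<^sub>3 \<in> \<C>"
    and "p\<^sub>1 \<noteq> p\<^sub>2" and "p\<^sub>1 \<noteq> p\<^sub>3" and "p\<^sub>2 \<noteq> p\<^sub>3"
    and "L = \<Lambda> / 2"
  shows "triangle_area p\<^sub>1 p\<^sub>2 p\<^sub>3 \<le> xbar k\<^sub>0 L * ybar k\<^sub>0 L \<and>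
    (triangle_area p\<^sub>1 p\<^sub>2 p\<^sub>3 = xbar k\<^sub>0 L * ybar k\<^sub>0 L \<longleftrightarrow>
      (\<forall>s\<in>{0..\<Lambda>}. affine_curvature {0..\<Lambda>} c s = k\<^sub>0) \<and>
      {p\<^sub>1, p\<^sub>2, p\<^sub>3} = {c 0, c (\<Lambda> / 2), c \<Lambda>})"
proof -
  let ?D = "deriv_on {0..\<Lambda>}" and ?\<kappa> = "affine_curvature {0..\<Lambda>} c"
  have pos: "0 < \<Lambda>" and image: "\<C> = c ` {0..\<Lambda>}"
    using assms(2) by (auto simp: affine_unit_speed_param_def bij_betw_def)
  interpret affine_curve \<Lambda> c "?D c" "?D (?D c)" ?\<kappa>
    by (rule affine_curve_of_param[OF assms(2)])
  interpret affine_curve_bounded \<Lambda> c "?D c" "?D (?D c)" ?\<kappa> k\<^sub>0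
    by unfold_locales (use pos assms(3,4) in \<open>auto intro: order.trans\<close>)
  have bound: "xbar k\<^sub>0 L * ybar k\<^sub>0 L = model_area k\<^sub>0 (\<Lambda> / 2) (\<Lambda> / 2) / 2"
    by (simp add: model_area_diagonal assms(11))
  obtain a b d where abd: "a \<in> {0..\<Lambda>}" "b \<in> {0..\<Lambda>}" "d \<in> {0..\<Lambda>}" "a < b" "b < d"
    and P: "{p\<^sub>1, p\<^sub>2, p\<^sub>3} = {c a, c b, c d}"
    using obtain_sorted_parameters[OF assms(5-7)[unfolded image] assms(8-10)] by metis
  have area: "triangle_area p\<^sub>1 p\<^sub>2 p\<^sub>3 = triangle_area (c a) (c b) (c d)"
    by (simp add: triangle_area_def P)
  have abd': "0 \<le> a" "a < b" "b < d" "d \<le> \<Lambda>" using abd by simp_all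
  note le = triangle_area_le_model[OF abd'] model_area_le_balanced[OF k_le, of "b - a" "d - b"]
  show ?thesis
  proof (intro conjI iffI)
    show "triangle_area p\<^sub>1 p\<^sub>2 p\<^sub>3 \<le> xbar k\<^sub>0 L * ybar k\<^sub>0 L"
      using le(1,2) abd' unfolding area bound by simp
  next
    assume eq: "triangle_area p\<^sub>1 p\<^sub>2 p\<^sub>3 = xbar k\<^sub>0 L * ybar k\<^sub>0 L"
    have "model_area k\<^sub>0 (b - a) (d - b) = model_area k\<^sub>0 (\<Lambda> / 2) (\<Lambda> / 2)"
      using le(1,2) abd' eq unfolding area bound by simp
    with le(3) abd' have "b - a = \<Lambda> / 2" "d - b = \<Lambda> / 2" by simp_all
    with abd' have abd_eq: "a = 0" "b = \<Lambda> / 2" "d = \<Lambda>" by simp_all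
    show "{p\<^sub>1, p\<^sub>2, p\<^sub>3} = {c 0, c (\<Lambda> / 2), c \<Lambda>}"
      unfolding P abd_eq ..
    have interior: "?\<kappa> r = k\<^sub>0" if "r \<in> {0<..<\<Lambda>}" for r
      by (rule curvature_eq_of_area_eq[OF abd'])
         (use eq that in \<open>simp_all add: area bound abd_eq\<close>)
    show "\<forall>s\<in>{0..\<Lambda>}. ?\<kappa> s = k\<^sub>0"
      using continuous_constant_on_closure[of "{0<..<\<Lambda>}" ?\<kappa> k\<^sub>0] interior pos
        continuous_on_affine_curvature[OF assms(2)] by simp
  next
    assume *: "(\<forall>s\<in>{0..\<Lambda>}. ?\<kappa> s = k\<^sub>0) \<and> {p\<^sub>1, p\<^sub>2, p\<^sub>3} = {c 0, c (\<Lambda> / 2), c \<Lambda>}"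
    then have "triangle_area p\<^sub>1 p\<^sub>2 p\<^sub>3 = triangle_area (c 0) (c (\<Lambda> / 2)) (c \<Lambda>)"
      by (simp add: triangle_area_def)
    also have "\<dots> = model_area k\<^sub>0 (\<Lambda> / 2 - 0) (\<Lambda> - \<Lambda> / 2) / 2"
      using * pos by (intro triangle_area_eq_model) simp_all
    finally show "triangle_area p\<^sub>1 p\<^sub>2 p\<^sub>3 = xbar k\<^sub>0 L * ybar k\<^sub>0 L"
      by (simp add: bound)
  qed
qed

end
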